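(* Let $d\ge 2$ and $t\ge d^2-d+3$ be integers, and let $T_t$ be a tree on $t$ vertices. Then every $T_t$-free graph $G$ satisfies $$\rho_{t-d}(G)\le\rho_{t-d}(K_{t-1})=\binom{t-2}{t-d-1}=\binom{t-2}{d-1}.$$ If $|V(G)|\ge t-1$, equality $\rho_{t-d}(G)=\rho_{t-d}(K_{t-1})$ holds if and only if $$G=K_{t-1}\,\dot\cup\, H,$$ where $H$ is an arbitrary $T_t$-free graph.
   Context: All graphs are finite, simple and undirected. $K_m$ is the complete graph on $m$ vertices. A graph $G$ is $F$-free if it contains no (not necessarily induced) subgraph isomorphic to $F$. $G_1\dot\cup G_2$ is the vertex-disjoint union, with no edges between the two graphs; $H$ is allowed to have no vertices; equality of graphs is up to isomorphism. For an integer $r\ge 2$, let $\mathcal C_r(G)$ be the family of $r$-cliques (copies of $K_r$) of $G$. For a graph $G$ with vertices indexed $1,\dots,n$, the $r$-clique tensor of $G$ is the order-$r$, dimension-$n$ symmetric tensor $\mathcal A_r(G)=(a_{i_1\ldots i_r})$ with $a_{i_1\ldots i_r}=\frac{1}{(r-1)!}$ if $\{i_1,\ldots,i_r\}\in\mathcal C_r(G)$ and $0$ otherwise. Its spectral radius is called the $r$-clique spectral radius $\rho_r(G)$. Equivalently (variational characterization), $$\rho_r(G)=\max\Big\{ r\sum_{\{i_1,\ldots,i_r\}\in\mathcal C_r(G)}x_{i_1}\cdots x_{i_r} : x_i\ge 0,\ \sum_{i=1}^n x_i^r=1\Big\}.$$ *)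

theory Defs
  imports Complex_Main "Graph_Theory.Graph_Theory"
begin

text \<open>
  Finite simple undirected graphs are the \<open>pair_graph\<close>s of Graph_Theory, i.e. finite, symmetric,
  loop-free digraphs without parallel arcs: an edge \<open>uv\<close> is the pair of arcs \<open>(u,v)\<close>, \<open>(v,u)\<close>.
\<close>

text \<open>
  The library constant \<open>tree\<close> cannot be used for such graphs: it forbids all directed cycles, and
  the two arcs of a single edge already form one, of length 2.  The cycles of the undirected graph
  are the directed cycles of length at least 3.
\<close>
definition graph_tree :: "'a pair_pre_digraph \<Rightarrow> bool" where
  "graph_tree T \<longleftrightarrow> pair_graph T \<and> connected (with_proj T) \<and>
     \<not> (\<exists>p. pre_digraph.cycle (with_proj T) p \<and> length p \<ge> 3)"

definition graph_free :: "'b pair_pre_digraph \<Rightarrow> 'a pair_pre_digraph \<Rightarrow> bool" where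
  "graph_free F G \<longleftrightarrow>
     \<not> (\<exists>S. pair_graph S \<and> subgraph (with_proj S) (with_proj G) \<and>
            digraph_iso (with_proj F) (with_proj S))"

definition complete_graph :: "nat \<Rightarrow> nat pair_pre_digraph" where
  "complete_graph m = \<lparr> pverts = {..<m}, parcs = {(u, v). u < m \<and> v < m \<and> u \<noteq> v} \<rparr>"

lemma complete_graph_complete_digraph: "K\<^bsub>m\<^esub> (with_proj (complete_graph m))"
proof -
  have "finite {(u, v). u < m \<and> v < m \<and> u \<noteq> v}"
    by (rule finite_subset[of _ "{..<m} \<times> {..<m}"]) auto
  then show ?thesis
    unfolding complete_digraph_pair_def complete_graph_def by auto
qed

definition disjoint_union ::
    "'a pair_pre_digraph \<Rightarrow> 'b pair_pre_digraph \<Rightarrow> ('a + 'b) pair_pre_digraph" where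
  "disjoint_union G H =
     \<lparr> pverts = pverts G <+> pverts H,
       parcs = map_prod Inl Inl ` parcs G \<union> map_prod Inr Inr ` parcs H \<rparr>"

text \<open>Cliques are identified with their vertex sets.\<close>
definition cliques :: "nat \<Rightarrow> 'a pair_pre_digraph \<Rightarrow> 'a set set" where
  "cliques r G =
     {C. C \<subseteq> pverts G \<and> card C = r \<and> (\<forall>u\<in>C. \<forall>v\<in>C. u \<noteq> v \<longrightarrow> (u, v) \<in> parcs G)}"

text \<open>
  A real tensor of order \<open>r\<close> whose indices range over a finite set \<open>I\<close> is a function \<open>a\<close> on index
  lists, of which only the lists of length \<open>r\<close> over \<open>I\<close> matter.  Its eigenvalues are the complex
  \<open>z\<close> with \<open>A x\<^sup>r\<^sup>-\<^sup>1 = z x\<^sup>[\<^sup>r\<^sup>-\<^sup>1\<^sup>]\<close> for some nonzero complex vector \<open>x\<close>: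
  the left-hand vector has the \<open>i\<close>-th entry obtained by contracting all indices but the first with
  \<open>x\<close>, and \<open>x\<^sup>[\<^sup>r\<^sup>-\<^sup>1\<^sup>]\<close> is the componentwise power.
\<close>
definition tensor_eigenvalue ::
    "nat \<Rightarrow> 'a set \<Rightarrow> ('a list \<Rightarrow> real) \<Rightarrow> complex \<Rightarrow> bool" where
  "tensor_eigenvalue r I a z \<longleftrightarrow>
     (\<exists>x :: 'a \<Rightarrow> complex. (\<exists>i\<in>I. x i \<noteq> 0) \<and>
        (\<forall>i\<in>I. (\<Sum>js | set js \<subseteq> I \<and> length js = r - 1.
                    complex_of_real (a (i # js)) * prod_list (map x js))
               = z * x i ^ (r - 1)))"

text \<open>
  The largest modulus of an eigenvalue.  Inserting 0 matters only when there is no eigenvalue at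
  all, as for an empty index set, where it fixes the spectral radius to be 0.
\<close>
definition tensor_spectral_radius :: "nat \<Rightarrow> 'a set \<Rightarrow> ('a list \<Rightarrow> real) \<Rightarrow> real" where
  "tensor_spectral_radius r I a = Sup (insert 0 {cmod z | z. tensor_eigenvalue r I a z})"

definition clique_tensor :: "nat \<Rightarrow> 'a pair_pre_digraph \<Rightarrow> 'a list \<Rightarrow> real" where
  "clique_tensor r G is = (if length is = r \<and> set is \<in> cliques r G then 1 / fact (r - 1) else 0)"

definition clique_spectral_radius :: "nat \<Rightarrow> 'a pair_pre_digraph \<Rightarrow> real" where
  "clique_spectral_radius r G = tensor_spectral_radius r (pverts G) (clique_tensor r G)"

end

theory Submission
  imports Defs "HOL-Combinatorics.Multiset_Permutations"
begin

text \<open>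
  Put \<open>r = t - d\<close>.  The eigenvalue equation of the clique tensor reads
  \<open>z x\<^sub>i\<^sup>r\<^sup>-\<^sup>1 = (\<Sum>C. \<Prod>j\<in>C - {i}. x\<^sub>j)\<close>, where \<open>C\<close> runs over the \<open>r\<close>-cliques through
  \<open>i\<close>; at an index where \<open>x\<close> has maximal modulus it shows that \<open>cmod z\<close> is at most the number of
  \<open>r\<close>-cliques through \<open>i\<close>.  This reduces the theorem to counting:
  in a \<open>T\<close>-free graph the \<open>r\<close>-cliques through any one vertex together cover at most \<open>t - 1\<close>
  vertices (\<open>cliques_at_vertex_span\<close>), hence there are at most \<open>(t - 2) choose (r - 1)\<close> of them.
  Equality forces the \<open>t - 1\<close> vertices to form a clique, and this clique has no edge to the rest of
  the graph, because \<open>T\<close> would embed with a leaf at the outer end of such an edge and its other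
  vertices in the clique.
  Conversely, the indicator vector of an isolated \<open>K\<^sub>t\<^sub>-\<^sub>1\<close> is an eigenvector for the bound.

  The covering statement rests on two ways of finding \<open>T\<close> in a union of cliques.
  First, two \<open>r\<close>-cliques that meet and cover at least \<open>t\<close> vertices contain \<open>T\<close>: the tree splits at
  some vertex \<open>p\<close> into two parts of at least \<open>d\<close> vertices with no edge between them
  (\<open>one_degenerate_balanced_split\<close>), and one part is placed in each clique, with \<open>p\<close> at a common
  vertex.  So meeting \<open>r\<close>-cliques differ in at most \<open>d - 1\<close> vertices.
  Second, \<open>T\<close> has an independent set of \<open>d\<close> vertices with at most \<open>d\<close> neighbours in all
  (\<open>one_degenerate_independent_set\<close>).  If the cliques through a vertex covered \<open>t\<close> vertices, the
  independent set could be placed on \<open>d\<close> vertices outside one clique \<open>C\<^sub>1\<close>, provided that these have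
  \<open>d\<close> common neighbours in \<open>C\<^sub>1\<close>.  To secure these, \<open>C\<^sub>1\<close> and \<open>C\<^sub>2\<close> are chosen as far apart as
  possible, \<open>C\<^sub>2 - C\<^sub>1\<close> having \<open>a\<close> elements.  A clique with a vertex outside \<open>C\<^sub>1 \<union> C\<^sub>2\<close> then misses
  at most \<open>a - 1\<close> vertices of \<open>C\<^sub>1 \<inter> C\<^sub>2\<close>, and \<open>d - a\<close> such vertices suffice.  The common
  neighbourhood that remains has at least \<open>t - d - a - (d - a) (a - 1)\<close> elements, which is at least
  \<open>d\<close> as soon as \<open>t \<ge> d\<^sup>2 - d + 3\<close>.
\<close>

section \<open>Trees as one-degenerate relations\<close>

text \<open>
  For a finite \<open>V\<close> and a symmetric irreflexive \<open>E\<close> this says that \<open>E\<close> is a forest on \<open>V\<close>.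
  Unlike connectedness, it passes to subsets of \<open>V\<close>, so that it supports induction by removing
  vertices.
\<close>
definition one_degenerate :: "'b rel \<Rightarrow> 'b set \<Rightarrow> bool" where
  "one_degenerate E V \<longleftrightarrow> (\<forall>X\<subseteq>V. X \<noteq> {} \<longrightarrow> (\<exists>v\<in>X. card (E `` {v} \<inter> X) \<le> 1))"

lemma one_degenerate_subset: "one_degenerate E V \<Longrightarrow> W \<subseteq> V \<Longrightarrow> one_degenerate E W"
  unfolding one_degenerate_def by blast

lemma vertex_list_awalk:
  assumes "successively (\<lambda>u v. (u, v) \<in> R) (x # zs)"
  shows "pcas x (zip (x # zs) zs) (last (x # zs))"
    and "pawalk_verts x (zip (x # zs) zs) = x # zs"
    and "set (zip (x # zs) zs) \<subseteq> R"
  using assms by (induction zs arbitrary: x) auto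

text \<open>
  If every vertex of \<open>X\<close> had two neighbours in \<open>X\<close>, consider a longest path inside \<open>X\<close>.  All
  neighbours of its first vertex lie on the path, and the one that is not the second vertex closes a
  cycle of length at least 3.
\<close>
lemma graph_tree_one_degenerate:
  assumes "graph_tree T"
  shows "one_degenerate (parcs T) (pverts T)"
  unfolding one_degenerate_def
proof (intro allI impI, rule ccontr)
  fix X assume X: "X \<subseteq> pverts T" "X \<noteq> {}"
    and no_leaf: "\<not> (\<exists>v\<in>X. card (parcs T `` {v} \<inter> X) \<le> 1)"
  interpret pair_graph T using assms unfolding graph_tree_def by blast
  have finX: "finite X" using X finite_subset pair_finite_verts by blast
  define path where "path = (\<lambda>xs. xs \<noteq> [] \<and> distinct xs \<and> set xs \<subseteq> X \<and>
    successively (\<lambda>u v. (u, v) \<in> parcs T) xs)"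
  from X obtain x0 where "x0 \<in> X" by blast
  then have "path [x0]" by (simp add: path_def)
  moreover have "\<forall>xs. path xs \<longrightarrow> length xs \<le> card X"
    by (metis path_def card_mono distinct_card finX)
  ultimately obtain xs where xs: "path xs" and longest: "\<And>ys. path ys \<Longrightarrow> length ys \<le> length xs"
    using ex_has_greatest_nat[of path "[x0]" length "Suc (card X)"] by (metis le_imp_less_Suc)
  then obtain x ys where xs_eq: "xs = x # ys" by (cases xs) (auto simp: path_def)
  have "x \<in> X" using xs xs_eq by (auto simp: path_def)
  then have two: "2 \<le> card (parcs T `` {x} \<inter> X)" using no_leaf by fastforce
  \<comment> \<open>Otherwise the path could be extended at its first vertex.\<close>
  have sub: "parcs T `` {x} \<inter> X \<subseteq> set ys"
  proof
    fix y assume y: "y \<in> parcs T `` {x} \<inter> X"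
    then have "(y, x) \<in> parcs T" "y \<noteq> x" using arcs_symmetric no_loops' by blast+
    show "y \<in> set ys"
    proof (rule ccontr)
      assume "y \<notin> set ys"
      then have "path (y # xs)" using y xs \<open>(y, x) \<in> parcs T\<close> \<open>y \<noteq> x\<close> by (auto simp: path_def xs_eq)
      then show False using longest by fastforce
    qed
  qed
  have "\<not> parcs T `` {x} \<inter> X \<subseteq> {hd ys}"
    using two card_mono[of "{hd ys}" "parcs T `` {x} \<inter> X"] by auto
  then obtain y where y: "(x, y) \<in> parcs T" "y \<in> X" "y \<noteq> hd ys" by blast
  then have "y \<in> set ys" using sub by blast
  then obtain as bs where ys: "ys = as @ y # bs" by (meson split_list)
  then have "as \<noteq> []" using y by auto
  define p where "p = (y, x) # zip (x # as @ [y]) (as @ [y])"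
  have xs_eq': "xs = (x # as @ [y]) @ bs" by (simp add: xs_eq ys)
  have succ: "successively (\<lambda>u v. (u, v) \<in> parcs T) (x # as @ [y])"
    using xs unfolding path_def xs_eq' successively_append_iff by blast
  have dist: "distinct (x # as @ [y])" using xs unfolding path_def xs_eq' by simp
  note walk = vertex_list_awalk[OF succ]
  have "cycle p"
    unfolding cycle_def
  proof (intro exI conjI)
    show "awalk y p y"
      unfolding awalk_def p_def using walk(1,3) y arcs_symmetric X by auto
    show "distinct (tl (pawalk_verts y p))"
      unfolding p_def using walk(2) dist by simp
    show "p \<noteq> []" by (simp add: p_def)
  qed
  moreover have "length p \<ge> 3" using \<open>as \<noteq> []\<close> by (cases as) (auto simp: p_def)
  ultimately show False using assms unfolding graph_tree_def by blast
qed

text \<open>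
  A vertex \<open>l\<close> with at most one neighbour is put into the set, and \<open>l\<close> and that neighbour are deleted
  before the next step.  Each step costs at most two vertices and creates at most one new neighbour.
\<close>
lemma one_degenerate_independent_set:
  assumes "finite V" "sym E" "irrefl E"
  shows "one_degenerate E V \<Longrightarrow> 2 * k \<le> card V + 1 \<Longrightarrow>
    \<exists>A\<subseteq>V. card A = k \<and> E `` A \<inter> A = {} \<and> card (E `` A \<inter> V) \<le> k"
  using assms(1)
proof (induction k arbitrary: V)
  case 0
  show ?case by (intro exI[of _ "{}"]) simp
next
  case (Suc k)
  then have "V \<noteq> {}" by auto
  then obtain l where l: "l \<in> V" "card (E `` {l} \<inter> V) \<le> 1"
    using Suc.prems unfolding one_degenerate_def by blast
  define N where "N = E `` {l} \<inter> V"
  have "finite N" using Suc.prems by (simp add: N_def)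
  have "card (insert l N) \<le> 2" using l \<open>finite N\<close> by (simp add: N_def card_insert_if)
  then have "card V - card (V - insert l N) \<le> 2"
    using Suc.prems l \<open>finite N\<close> by (subst card_Diff_subset) (auto simp: N_def)
  then have "2 * k \<le> card (V - insert l N) + 1" using Suc.prems(2) by arith
  moreover have "one_degenerate E (V - insert l N)" using one_degenerate_subset[OF Suc.prems(1)] by simp
  ultimately obtain A where A: "A \<subseteq> V - insert l N" "card A = k" "E `` A \<inter> A = {}"
      "card (E `` A \<inter> (V - insert l N)) \<le> k"
    using Suc.IH[of "V - insert l N"] Suc.prems(3) by auto
  have "finite A" using A Suc.prems finite_subset by blast
  have no: "(l, a) \<notin> E" "(a, l) \<notin> E" if "a \<in> A" for a
    using that A(1) assms(2) by (auto simp: N_def dest: symD)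
  have "(l, l) \<notin> E" using assms(3) by (auto simp: irrefl_def)
  have "E `` insert l A \<inter> V \<subseteq> N \<union> (E `` A \<inter> (V - insert l N))"
    using no by (auto simp: N_def)
  then have "card (E `` insert l A \<inter> V) \<le> card (N \<union> (E `` A \<inter> (V - insert l N)))"
    using Suc.prems \<open>finite N\<close> by (intro card_mono) auto
  also have "\<dots> \<le> card N + card (E `` A \<inter> (V - insert l N))" by (rule card_Un_le)
  also have "\<dots> \<le> Suc k" using l A by (simp add: N_def)
  finally have nbrs: "card (E `` insert l A \<inter> V) \<le> Suc k" .
  have "E `` insert l A \<inter> insert l A = {}" using no A(3) \<open>(l, l) \<notin> E\<close> by blast
  moreover have "card (insert l A) = Suc k" using A \<open>finite A\<close> by (subst card_insert_disjoint) auto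
  ultimately show ?case using nbrs l A by (intro exI[of _ "insert l A"]) blast
qed

text \<open>
  Two neighbours of \<open>p\<close> in a forest lie in different components once \<open>p\<close> is deleted; \<open>K\<close> plays the
  part of the component of \<open>q\<close>.  A vertex \<open>l\<close> with at most one neighbour is either one of \<open>q\<close>,
  \<open>q'\<close>, and then a component by itself, or it can be deleted and given back to the side of its
  neighbour.
\<close>
lemma one_degenerate_separates_neighbours:
  assumes "sym E" "irrefl E" "finite V"
  shows "one_degenerate E V \<Longrightarrow> {p, q, q'} \<subseteq> V \<Longrightarrow> (p, q) \<in> E \<Longrightarrow> (p, q') \<in> E \<Longrightarrow> q \<noteq> q' \<Longrightarrow>
    \<exists>K\<subseteq>V - {p}. q \<in> K \<and> q' \<notin> K \<and> E `` K \<inter> V \<subseteq> insert p K"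
  using assms(3)
proof (induction V rule: finite_psubset_induct)
  case (psubset V)
  then have "V \<noteq> {}" by auto
  then obtain l where l: "l \<in> V" "card (E `` {l} \<inter> V) \<le> 1"
    using psubset.prems unfolding one_degenerate_def by blast
  have unique: "u = u'" if "(l, u) \<in> E" "(l, u') \<in> E" "u \<in> V" "u' \<in> V" for u u'
    using l(2) that card_le_Suc0_iff_eq[of "E `` {l} \<inter> V"] psubset.hyps by auto
  have irr: "(u, u) \<notin> E" for u using assms(2) by (auto simp: irrefl_def)
  have sy: "(v, u) \<in> E" if "(u, v) \<in> E" for u v using assms(1) that by (auto dest: symD)
  have "l \<noteq> p" using unique[of q q'] psubset.prems by auto
  consider "l = q" | "l = q'" | "l \<noteq> q" "l \<noteq> q'" by blast
  then show ?case
  proof cases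
    case 1
    then have "E `` {q} \<inter> V \<subseteq> {p}" using unique sy psubset.prems by blast
    then show ?thesis using psubset.prems irr by (intro exI[of _ "{q}"]) auto
  next
    case 2
    have "E `` {q'} \<inter> V \<subseteq> {p}" using 2 unique sy psubset.prems by blast
    then have "E `` (V - {p, q'}) \<inter> V \<subseteq> insert p (V - {p, q'})" using sy by blast
    then show ?thesis using psubset.prems irr by (intro exI[of _ "V - {p, q'}"]) auto
  next
    case 3
    have "one_degenerate E (V - {l})" using one_degenerate_subset[OF psubset.prems(1)] by simp
    moreover have "V - {l} \<subset> V" using l by blast
    ultimately obtain K where K: "K \<subseteq> V - {l} - {p}" "q \<in> K" "q' \<notin> K"
        "E `` K \<inter> (V - {l}) \<subseteq> insert p K"
      using psubset.IH[of "V - {l}"] psubset.prems 3 \<open>l \<noteq> p\<close> by auto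
    show ?thesis
    proof (cases "\<exists>u\<in>K. (l, u) \<in> E")
      case True
      then have "E `` {l} \<inter> V \<subseteq> K" using unique K(1) by blast
      then show ?thesis using K 3 l \<open>l \<noteq> p\<close> by (intro exI[of _ "insert l K"]) blast
    next
      case False
      then have "l \<notin> E `` K" using sy by blast
      then show ?thesis using K by (intro exI[of _ K]) blast
    qed
  qed
qed

text \<open>
  Among all vertices \<open>p\<close> and all sets \<open>A\<close> of at least \<open>d\<close> vertices whose neighbours outside \<open>A\<close> are
  at most \<open>p\<close>, take a smallest \<open>A\<close>.  If all neighbours of \<open>p\<close> in \<open>A\<close> coincide with one \<open>q\<close>, then
  \<open>q\<close> and \<open>A - {q}\<close> would be a smaller choice, unless \<open>A\<close> has just \<open>d\<close> elements.  If \<open>p\<close> has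
  two neighbours in \<open>A\<close>, then \<open>A\<close> falls into two parts that are closed apart from \<open>p\<close>, each with
  fewer than \<open>d\<close> elements, so \<open>A\<close> has at most \<open>2 d - 2\<close>.
\<close>
lemma one_degenerate_balanced_split:
  assumes "finite V" "sym E" "irrefl E" "one_degenerate E V"
    and "3 * d \<le> card V + 1" "2 * d + 1 \<le> card V"
  shows "\<exists>p\<in>V. \<exists>A\<subseteq>V - {p}. E `` A \<inter> V \<subseteq> insert p A \<and> d \<le> card A \<and> card A + d + 1 \<le> card V"
proof -
  define good where "good = (\<lambda>(p, A). p \<in> V \<and> A \<subseteq> V - {p} \<and> E `` A \<inter> V \<subseteq> insert p A \<and> d \<le> card A)"
  have "V \<noteq> {}" using assms by auto
  then obtain p0 where "p0 \<in> V" by blast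
  then have "good (p0, V - {p0})" using assms by (auto simp: good_def)
  then obtain p A where pA: "good (p, A)"
    and least: "\<And>q B. good (q, B) \<Longrightarrow> card A \<le> card B"
    using ex_has_least_nat[of good "(p0, V - {p0})" "\<lambda>(p, A). card A"] by fastforce
  have irr: "(u, u) \<notin> E" for u using assms(3) by (auto simp: irrefl_def)
  have sy: "(v, u) \<in> E" if "(u, v) \<in> E" for u v using assms(2) that by (auto dest: symD)
  have p: "p \<in> V" "A \<subseteq> V - {p}" "E `` A \<inter> V \<subseteq> insert p A" "d \<le> card A"
    using pA by (auto simp: good_def)
  have finA: "finite A" using p assms(1) finite_subset by blast
  have "card A + d + 1 \<le> card V"
  proof (rule ccontr)
    assume big: "\<not> ?thesis"
    show False
    proof (cases "\<exists>q\<in>A. E `` {p} \<inter> A \<subseteq> {q}")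
      case True
      then obtain q where q: "q \<in> A" "E `` {p} \<inter> A \<subseteq> {q}" by blast
      have "good (q, A - {q})"
        unfolding good_def using p q sy irr finA big assms(5,6) by auto blast
      then show False using least q finA card_Diff1_less by fastforce
    next
      case False
      then have "A = {} \<or> (\<exists>q\<in>A. \<exists>q'\<in>A. q \<noteq> q' \<and> (p, q) \<in> E \<and> (p, q') \<in> E)" by blast
      moreover have "A \<noteq> {}" using big assms(5,6) by auto
      ultimately obtain q q' where q: "q \<in> A" "q' \<in> A" "q \<noteq> q'" "(p, q) \<in> E" "(p, q') \<in> E" by blast
      have "one_degenerate E (insert p A)" using assms(4) p one_degenerate_subset by (metis Diff_subset insert_subset order_trans)
      then obtain K where "K \<subseteq> insert p A - {p}"
          and K': "q \<in> K" "q' \<notin> K" "E `` K \<inter> insert p A \<subseteq> insert p K"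
        using one_degenerate_separates_neighbours[of E "insert p A" p q q'] assms(2,3) q finA by auto
      then have K: "K \<subseteq> A" "q \<in> K" "q' \<notin> K" "E `` K \<inter> insert p A \<subseteq> insert p K"
        by auto
      have sub: "K \<subset> A" "A - K \<subset> A" using K q by blast+
      have "\<not> good (p, K)" using least[of p K] psubset_card_mono[OF finA sub(1)] by auto
      moreover have "\<not> good (p, A - K)"
        using least[of p "A - K"] psubset_card_mono[OF finA sub(2)] by auto
      moreover have "E `` K \<inter> V \<subseteq> insert p K" "E `` (A - K) \<inter> V \<subseteq> insert p (A - K)"
        using K p sy by blast+
      ultimately have "card K < d" "card (A - K) < d"
        using p K by (auto simp: good_def)
      moreover have "card A = card K + card (A - K)"
        using K finA by (metis card_Diff_subset card_mono finite_subset le_add_diff_inverse)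
      ultimately show False using big assms(5) by linarith
    qed
  qed
  then show ?thesis using p by blast
qed

section \<open>Embedding a forest into cliques\<close>

definition embedding :: "('b \<Rightarrow> 'a) \<Rightarrow> 'b pair_pre_digraph \<Rightarrow> 'a pair_pre_digraph \<Rightarrow> bool" where
  "embedding f T G \<longleftrightarrow> inj_on f (pverts T) \<and> f ` pverts T \<subseteq> pverts G \<and>
     (\<forall>u v. (u, v) \<in> parcs T \<longrightarrow> (f u, f v) \<in> parcs G)"

definition clique_on :: "'a rel \<Rightarrow> 'a set \<Rightarrow> bool" where
  "clique_on R C \<longleftrightarrow> (\<forall>u\<in>C. \<forall>v\<in>C. u \<noteq> v \<longrightarrow> (u, v) \<in> R)"

lemma clique_onD: "clique_on R C \<Longrightarrow> u \<in> C \<Longrightarrow> v \<in> C \<Longrightarrow> u \<noteq> v \<Longrightarrow> (u, v) \<in> R"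
  by (auto simp: clique_on_def)

text \<open>
  The image of \<open>T\<close> under an embedding is a subgraph isomorphic to \<open>T\<close>, so exhibiting an injective
  map that preserves edges is enough to refute freeness.
\<close>
lemma graph_free_no_embedding:
  assumes "pair_graph T" "pair_graph G" "graph_free T G"
  shows "\<not> embedding f T G"
proof
  assume f: "embedding f T G"
  interpret T: pair_graph T by fact
  interpret G: pair_graph G by fact
  define S where "S = \<lparr>pverts = f ` pverts T, parcs = map_prod f f ` parcs T\<rparr>"
  define h where "h = \<lparr>iso_verts = f, iso_arcs = map_prod f f, iso_head = snd, iso_tail = fst\<rparr>"
  have inj: "inj_on f (pverts T)" using f by (simp add: embedding_def)
  have S: "pair_graph S"
  proof
    show "\<And>e. e \<in> parcs S \<Longrightarrow> fst e \<in> pverts S" "\<And>e. e \<in> parcs S \<Longrightarrow> snd e \<in> pverts S"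
      using T.wellformed' by (auto simp: S_def)
    show "finite (pverts S)" "finite (parcs S)"
      using T.pair_finite_verts T.pair_finite_arcs by (auto simp: S_def)
    show "\<And>e. e \<in> parcs S \<Longrightarrow> fst e \<noteq> snd e"
      using T.no_loops' T.wellformed' inj unfolding S_def by (fastforce dest: inj_onD)
    show "symmetric (with_proj S)"
      using T.arcs_symmetric by (force simp: symmetric_def S_def intro: symI)
  qed
  then interpret S: pair_graph S .
  have "subgraph (with_proj S) (with_proj G)"
    using f by (auto simp: subgraph_def compatible_def S_def embedding_def
        G.wf_digraph S.wf_digraph[unfolded S_def])
  moreover have "inj_on (map_prod f f) (parcs T)"
    by (rule inj_on_subset[OF map_prod_inj_on[OF inj inj]]) (use T.wellformed' in auto)
  then have "T.digraph_isomorphism h"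
    using inj by (simp add: T.digraph_isomorphism_def h_def T.wf_digraph)
  then have "digraph_iso (with_proj T) (with_proj S)"
    unfolding digraph_iso_def by (intro exI[of _ h]) (simp add: app_iso_def h_def S_def with_proj_def)
  ultimately show False using S assms(3) unfolding graph_free_def by blast
qed

text \<open>
  The set \<open>A\<close> goes into \<open>C1\<close>, the rest into \<open>C2\<close>, and \<open>p\<close> to the common vertex \<open>c\<close>.  The two parts
  may compete for \<open>C1 \<inter> C2\<close>; there is room for both if \<open>A\<close> uses up \<open>C1 - C2\<close> first.
\<close>
lemma embeds_in_two_cliques:
  assumes V: "finite V" "p \<in> V" "A \<subseteq> V - {p}" and E: "sym E" "irrefl E" "E `` A \<inter> V \<subseteq> insert p A"
    and C: "finite C1" "finite C2" "clique_on R C1" "clique_on R C2" "c \<in> C1 \<inter> C2"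
    and card: "card A < card C1" "card V \<le> card A + card C2" "card V \<le> card (C1 \<union> C2)"
  shows "\<exists>f. inj_on f V \<and> f ` V \<subseteq> C1 \<union> C2 \<and> (\<forall>u\<in>V. \<forall>v\<in>V. (u, v) \<in> E \<longrightarrow> (f u, f v) \<in> R)"
proof -
  define B where "B = V - insert p A"
  have fin: "finite A" "finite B" using V finite_subset by (auto simp: B_def)
  have "card V = Suc (card A + card B)"
  proof -
    have "p \<notin> A" "A \<inter> B = {}" "p \<notin> A \<union> B" "V = insert p (A \<union> B)" using V by (auto simp: B_def)
    then show ?thesis using fin by (simp add: card_Un_disjoint)
  qed
  then have B: "card B \<le> card (C2 - {c})" "card A + card B \<le> card (C1 \<union> C2 - {c})"
    using card C by (auto simp: card_Diff_singleton)
  have A: "card A \<le> card (C1 - {c})" using card C by (auto simp: card_Diff_singleton)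
  have "\<exists>A'\<subseteq>C1 - {c}. card A' = card A \<and> card B \<le> card (C2 - {c} - A')"
  proof (cases "card A \<le> card (C1 - C2)")
    case True
    then obtain A' where "A' \<subseteq> C1 - C2" "card A' = card A" by (rule obtain_subset_with_card_n)
    moreover from this have "C2 - {c} - A' = C2 - {c}" by blast
    ultimately show ?thesis using B C(5) by (intro exI[of _ A']) auto
  next
    case False
    then have "\<exists>A'. C1 - C2 \<subseteq> A' \<and> A' \<subseteq> C1 - {c} \<and> card A' = card A"
      using A C by (intro exists_subset_between) auto
    then obtain A' where A': "C1 - C2 \<subseteq> A'" "A' \<subseteq> C1 - {c}" "card A' = card A" by blast
    then have "C2 - {c} - A' = (C1 \<union> C2 - {c}) - A'" by blast
    moreover have "card ((C1 \<union> C2 - {c}) - A') = card (C1 \<union> C2 - {c}) - card A"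
      using A' C finite_subset[of A' C1] by (subst card_Diff_subset) auto
    ultimately show ?thesis using A' B by (intro exI[of _ A']) auto
  qed
  then obtain A' where A': "A' \<subseteq> C1 - {c}" "card A' = card A" "card B \<le> card (C2 - {c} - A')"
    by blast
  obtain g where g: "g ` A \<subseteq> A'" "inj_on g A"
    using card_le_inj[of A A'] A' fin C finite_subset[of A' C1] by fastforce
  obtain h where h: "h ` B \<subseteq> C2 - {c} - A'" "inj_on h B"
    using card_le_inj[of B "C2 - {c} - A'"] A' fin C by fastforce
  define f where "f = (\<lambda>u. if u = p then c else if u \<in> A then g u else h u)"
  have fA: "f u \<in> C1 - {c}" "f u \<in> A'" "f u = g u" if "u \<in> A" for u
    using that V A' g by (auto simp: f_def)
  have fB: "f u \<in> C2 - {c} - A'" "f u = h u" if "u \<in> B" for u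
    using that h by (auto simp: f_def B_def)
  have fp: "f p = c" by (simp add: f_def)
  have VU: "V = insert p (A \<union> B)" using V by (auto simp: B_def)
  have inj: "inj_on f V"
  proof (rule inj_onI)
    fix u v assume "u \<in> V" "v \<in> V" "f u = f v"
    then show "u = v"
      unfolding VU using fA fB fp g(2) h(2) by (metis DiffD2 DiffE Un_iff inj_onD insertE singletonI)
  qed
  moreover have "f ` V \<subseteq> C1 \<union> C2" unfolding VU using fA fB fp C(5) by auto
  moreover have "(f u, f v) \<in> R" if uv: "u \<in> V" "v \<in> V" "(u, v) \<in> E" for u v
  proof -
    have "u \<noteq> v" using uv E(2) by (auto simp: irrefl_def)
    then have "f u \<noteq> f v" using inj uv by (auto dest: inj_onD)
    have "{u, v} \<subseteq> insert p A \<or> {u, v} \<subseteq> insert p B"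
      using uv E V unfolding B_def by (auto dest: symD)
    then have "{f u, f v} \<subseteq> C1 \<or> {f u, f v} \<subseteq> C2" using fA fB fp C(5) by blast
    then show ?thesis using C \<open>f u \<noteq> f v\<close> clique_onD by (metis insert_subset)
  qed
  ultimately show ?thesis by blast
qed

text \<open>
  Inside the clique \<open>C\<close> every placement is correct.  Only the vertices placed on \<open>W\<close> need care: they
  form an independent set, and their neighbours are placed on \<open>D\<close>, which is completely joined to
  \<open>W\<close>.
\<close>
lemma embeds_in_extended_clique:
  assumes V: "finite V" "A \<subseteq> V" and E: "sym E" "irrefl E" "E `` A \<inter> A = {}"
    and R: "sym R" and C: "finite C" "clique_on R C" "D \<subseteq> C" "finite W" "W \<inter> C = {}" "D \<times> W \<subseteq> R"
    and card: "card A \<le> card W" "card (E `` A \<inter> V) \<le> card D" "card V \<le> card A + card C"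
  shows "\<exists>f. inj_on f V \<and> f ` V \<subseteq> C \<union> W \<and> (\<forall>u\<in>V. \<forall>v\<in>V. (u, v) \<in> E \<longrightarrow> (f u, f v) \<in> R)"
proof -
  define N where "N = E `` A \<inter> V"
  define M where "M = V - A - N"
  have fin: "finite A" "finite N" "finite M" using V finite_subset by (auto simp: M_def N_def)
  have disj: "A \<inter> N = {}" using E by (auto simp: N_def)
  have "card V = card A + card N + card M"
  proof -
    have "V = A \<union> (N \<union> M)" "A \<inter> (N \<union> M) = {}" "N \<inter> M = {}"
      using V disj by (auto simp: M_def N_def)
    then show ?thesis using fin by (metis add.assoc card_Un_disjoint finite_UnI)
  qed
  have "finite D" using C finite_subset by blast
  obtain g where g: "g ` A \<subseteq> W" "inj_on g A"
    using card_le_inj[of A W] card C fin by blast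
  obtain h where h: "h ` N \<subseteq> D" "inj_on h N"
    using card_le_inj[of N D] card \<open>finite D\<close> fin unfolding N_def by blast
  have "card (C - h ` N) = card C - card N"
    using h C fin by (subst card_Diff_subset) (auto simp: card_image)
  then have "card M \<le> card (C - h ` N)"
    using \<open>card V = card A + card N + card M\<close> card by linarith
  then obtain k where k: "k ` M \<subseteq> C - h ` N" "inj_on k M"
    using card_le_inj[of M "C - h ` N"] C fin by blast
  define f where "f = (\<lambda>u. if u \<in> A then g u else if u \<in> N then h u else k u)"
  have fA: "f u \<in> W" "f u = g u" if "u \<in> A" for u using that g by (auto simp: f_def)
  have fN: "f u \<in> D" "f u = h u" "f u \<in> h ` N" if "u \<in> N" for u
    using that h disj by (auto simp: f_def)
  have fM: "f u \<in> C - h ` N" "f u = k u" if "u \<in> M" for u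
    using that k by (auto simp: f_def M_def)
  have VU: "V = A \<union> N \<union> M" using V by (auto simp: M_def N_def)
  have inj: "inj_on f V"
  proof (rule inj_onI)
    fix u v assume *: "u \<in> V" "v \<in> V" "f u = f v"
    have inA: "x \<in> A \<longleftrightarrow> f x \<notin> C" and inN: "x \<in> N \<longleftrightarrow> f x \<in> h ` N" if "x \<in> V" for x
      using that fA(1)[of x] fN(1,3)[of x] fM(1)[of x] h(1) C(3,5) unfolding VU by blast+
    have "u \<in> A \<longleftrightarrow> v \<in> A" "u \<in> N \<longleftrightarrow> v \<in> N"
      using inA[of u] inA[of v] inN[of u] inN[of v] * by simp_all
    then consider "u \<in> A" "v \<in> A" | "u \<in> N" "v \<in> N" | "u \<in> M" "v \<in> M"
      using *(1,2) unfolding VU by blast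
    then show "u = v"
    proof cases
      case 1 then show ?thesis using *(3) fA(2) inj_onD[OF g(2)] by simp
    next
      case 2 then show ?thesis using *(3) fN(2) inj_onD[OF h(2)] by simp
    next
      case 3 then show ?thesis using *(3) fM(2) inj_onD[OF k(2)] by simp
    qed
  qed
  moreover have "f ` V \<subseteq> C \<union> W" unfolding VU using fA fN fM C by blast
  moreover have "(f u, f v) \<in> R" if uv: "u \<in> V" "v \<in> V" "(u, v) \<in> E" for u v
  proof -
    have "u \<noteq> v" using uv E(2) by (auto simp: irrefl_def)
    then have ne: "f u \<noteq> f v" using inj uv by (auto dest: inj_onD)
    have "(v, u) \<in> E" using uv E by (auto dest: symD)
    then consider "u \<in> A" "v \<in> N" | "v \<in> A" "u \<in> N" | "u \<in> N \<union> M" "v \<in> N \<union> M"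
      using uv E(3) unfolding N_def M_def by blast
    then show ?thesis
    proof cases
      case 3
      then have "f u \<in> C" "f v \<in> C" using fN fM C by blast+
      then show ?thesis using clique_onD[OF C(2)] ne by simp
    next
      case 1
      then have "(f v, f u) \<in> R" using fA(1)[of u] fN(1)[of v] C(6) by blast
      then show ?thesis using R by (auto dest: symD)
    next
      case 2
      then show ?thesis using fA(1)[of v] fN(1)[of u] C(6) by blast
    qed
  qed
  ultimately show ?thesis by blast
qed

section \<open>Cliques in graphs without a given tree\<close>

lemma graph_free_no_injection:
  assumes "pair_graph T" "pair_graph G" "graph_free T G"
    and "\<exists>f. inj_on f (pverts T) \<and> f ` pverts T \<subseteq> X \<and>
      (\<forall>u\<in>pverts T. \<forall>v\<in>pverts T. (u, v) \<in> parcs T \<longrightarrow> (f u, f v) \<in> parcs G)"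
    and "X \<subseteq> pverts G"
  shows False
proof -
  interpret T: pair_graph T by fact
  obtain f where "inj_on f (pverts T)" "f ` pverts T \<subseteq> X"
      "\<forall>u\<in>pverts T. \<forall>v\<in>pverts T. (u, v) \<in> parcs T \<longrightarrow> (f u, f v) \<in> parcs G"
    using assms(4) by blast
  then have "embedding f T G"
    unfolding embedding_def using assms(5) T.wellformed' by blast
  then show False using graph_free_no_embedding assms by blast
qed

lemma pair_graph_relation:
  assumes "pair_graph G"
  shows "finite (pverts G)" "sym (parcs G)" "irrefl (parcs G)"
proof -
  interpret pair_graph G by fact
  show "finite (pverts G)" by (rule pair_finite_verts)
  show "sym (parcs G)" by (rule symI) (rule arcs_symmetric)
  show "irrefl (parcs G)" using no_loops' by (auto simp: irrefl_def)
qed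

lemma cliquesD:
  assumes "C \<in> cliques r G"
  shows "C \<subseteq> pverts G" "card C = r" "clique_on (parcs G) C"
  using assms by (auto simp: cliques_def clique_on_def)

text \<open>
  This is where the quadratic lower bound on \<open>t\<close> enters.  The left-hand side adds up \<open>d\<close> required
  common neighbours and the vertices of a clique that may be lost, \<open>a\<close> of them to a clique at largest
  distance and at most \<open>a - 1\<close> to each of \<open>d - a\<close> further cliques.  For \<open>a = 0\<close> the truncated
  \<open>a - 1\<close> is 0, and the bound says \<open>2 d \<le> t\<close>.
\<close>
lemma core_bound:
  fixes a d t :: nat
  assumes "d \<ge> 2" "t \<ge> d ^ 2 - d + 3" "a < d"
  shows "d + (d - a) * (a - 1) + a \<le> t - d"
proof -
  obtain c where d: "d = a + Suc c" using assms(3) less_iff_Suc_add by auto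
  have "2 * d + (d - a) * (a - 1) + a \<le> d ^ 2 - d + 3"
  proof (cases a)
    case 0
    obtain e where "d = 2 + e" using assms(1) le_Suc_ex by blast
    then show ?thesis using 0 by (simp add: power2_eq_square algebra_simps)
  next
    case (Suc e)
    then show ?thesis
      using d by (simp add: power2_eq_square algebra_simps) (metis le_square trans_le_add2)
  qed
  then show ?thesis using assms by linarith
qed

lemma tree_size_bounds:
  fixes d t :: nat
  assumes "d \<ge> 2" "t \<ge> d ^ 2 - d + 3"
  shows "3 * d \<le> t + 1" "2 * d + 1 \<le> t" "3 \<le> t - d"
proof -
  obtain e where e: "d = 2 + e" using assms(1) le_Suc_ex by blast
  have "5 + 3 * e + e * e \<le> t" using assms(2) e by (simp add: power2_eq_square algebra_simps)
  then show "3 * d \<le> t + 1" "2 * d + 1 \<le> t" "3 \<le> t - d" using e by simp_all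
qed

text \<open>
  Two \<open>r\<close>-cliques, \<open>r = t - d\<close>, that meet and differ in \<open>d\<close> or more vertices cover at least \<open>t\<close>
  vertices, which is room for the tree: split in a balanced way, both of its parts fit into the
  cliques.
\<close>
lemma meeting_cliques_close:
  assumes T: "graph_tree T" and G: "pair_graph G" "graph_free T G"
    and d: "3 * d \<le> card (pverts T) + 1" "2 * d + 1 \<le> card (pverts T)"
    and C: "C \<in> cliques (card (pverts T) - d) G" "C' \<in> cliques (card (pverts T) - d) G"
      "C \<inter> C' \<noteq> {}"
  shows "card (C' - C) < d"
proof (rule ccontr)
  define t where "t = card (pverts T)"
  assume far: "\<not> card (C' - C) < d"
  have pT: "pair_graph T" using T by (simp add: graph_tree_def)
  note E = pair_graph_relation[OF pT]
  note C1 = cliquesD[OF C(1)] and C2 = cliquesD[OF C(2)]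
  have fin: "finite C" "finite C'"
    using C1(1) C2(1) finite_subset pair_graph_relation(1)[OF G(1)] by blast+
  obtain c where c: "c \<in> C \<inter> C'" using C(3) by blast
  have "card (C \<union> C') = card C + card (C' - C)"
    using fin card_Un_disjoint[of C "C' - C"] by simp
  then have big: "t \<le> card (C \<union> C')"
    using C1(2) far unfolding t_def by linarith
  obtain p A where pA: "p \<in> pverts T" "A \<subseteq> pverts T - {p}" "parcs T `` A \<inter> pverts T \<subseteq> insert p A"
      "d \<le> card A" "card A + d + 1 \<le> t"
    using one_degenerate_balanced_split[OF E graph_tree_one_degenerate[OF T] d] unfolding t_def by blast
  have "card A < card C" "t \<le> card A + card C'"
    using pA C1(2) C2(2) unfolding t_def by linarith+
  then have "\<exists>f. inj_on f (pverts T) \<and> f ` pverts T \<subseteq> C \<union> C' \<and>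
      (\<forall>u\<in>pverts T. \<forall>v\<in>pverts T. (u, v) \<in> parcs T \<longrightarrow> (f u, f v) \<in> parcs G)"
    using embeds_in_two_cliques[OF E(1) pA(1,2) E(2,3) pA(3) fin C1(3) C2(3) c] big
    unfolding t_def by blast
  then show False
    using graph_free_no_injection[OF pT G] C1(1) C2(1) by blast
qed

text \<open>
  The combinatorial heart of the theorem.  If the cliques through \<open>v\<close> covered \<open>t\<close> vertices, then
  the tree could be placed on a clique \<open>C1\<close> and a set \<open>W\<close> of \<open>d\<close> vertices outside it that has at least
  \<open>d\<close> common neighbours in \<open>C1\<close>.
\<close>
lemma cliques_at_vertex_span:
  fixes T :: "'b pair_pre_digraph" and G :: "'a pair_pre_digraph"
  assumes d: "d \<ge> 2" "card (pverts T) \<ge> d ^ 2 - d + 3"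
    and T: "graph_tree T" and G: "pair_graph G" "graph_free T G"
  shows "card (\<Union>{C \<in> cliques (card (pverts T) - d) G. v \<in> C}) < card (pverts T)"
proof (rule ccontr)
  define t where "t = card (pverts T)"
  define F where "F = {C \<in> cliques (t - d) G. v \<in> C}"
  assume "\<not> ?thesis"
  then have big: "t \<le> card (\<Union>F)" unfolding F_def t_def by simp
  have pT: "pair_graph T" using T by (simp add: graph_tree_def)
  note E = pair_graph_relation[OF pT] and R = pair_graph_relation[OF G(1)]
  note bounds = tree_size_bounds[OF d, folded t_def]
  have FD: "C \<subseteq> pverts G" "card C = t - d" "clique_on (parcs G) C" "v \<in> C" "finite C" if "C \<in> F" for C
    using that cliquesD[of C "t - d" G] R(1) finite_subset[of C "pverts G"] by (auto simp: F_def)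
  have "finite F" using FD(1) R(1) by (intro finite_subset[of F "Pow (pverts G)"]) auto
  have close: "card (C' - C) < d" if "C \<in> F" "C' \<in> F" for C C'
    using meeting_cliques_close[OF T G, of d C C'] bounds that unfolding F_def t_def by auto
  have "F \<noteq> {}" using big bounds by auto
  \<comment> \<open>The first two cliques are chosen at largest distance; this is what limits the losses below.\<close>
  define gap where "gap = (\<lambda>(C :: 'a set, C' :: 'a set). card (C' - C))"
  have "finite (gap ` (F \<times> F))" "gap ` (F \<times> F) \<noteq> {}" using \<open>finite F\<close> \<open>F \<noteq> {}\<close> by auto
  then obtain C1 C2 where C: "C1 \<in> F" "C2 \<in> F" "gap (C1, C2) = Max (gap ` (F \<times> F))"
    using Max_in[of "gap ` (F \<times> F)"] by fastforce
  define a where "a = card (C2 - C1)"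
  have widest: "card (C' - C) \<le> a" if "C \<in> F" "C' \<in> F" for C C'
  proof -
    have "gap (C, C') \<le> gap (C1, C2)"
      unfolding C(3) using that \<open>finite F\<close> by (intro Max_ge) auto
    then show ?thesis by (simp add: gap_def a_def)
  qed
  have "a < d" using close C by (simp add: a_def)
  have card_diff: "card (C - C') = card (C' - C)" if "C \<in> F" "C' \<in> F" for C C'
    using FD[OF that(1)] FD[OF that(2)] card_Diff_subset_Int[of C C'] card_Diff_subset_Int[of C' C]
    by (simp add: Int_commute)
  have "card (C1 \<union> C2) = t - d + a"
    using FD[OF C(1)] FD[OF C(2)] card_Un_disjoint[of C1 "C2 - C1"] by (simp add: a_def)
  moreover have "finite (C1 \<union> C2)" "C1 \<union> C2 \<subseteq> \<Union>F" using C FD by auto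
  ultimately have "d - a \<le> card (\<Union>F - (C1 \<union> C2))"
    using big bounds by (subst card_Diff_subset) auto
  then obtain Z where Z: "Z \<subseteq> \<Union>F - (C1 \<union> C2)" "card Z = d - a" "finite Z"
    by (rule obtain_subset_with_card_n)
  \<comment> \<open>Together with \<open>C2 - C1\<close>, the set \<open>Z\<close> supplies \<open>d\<close> vertices outside \<open>C1\<close>.\<close>
  have "\<forall>z\<in>Z. \<exists>C\<in>F. z \<in> C" using Z by blast
  then obtain K where K: "K z \<in> F" "z \<in> K z" if "z \<in> Z" for z by metis
  have miss: "card (C1 \<inter> C2 - K z) \<le> a - 1" if z: "z \<in> Z" for z
  proof -
    note Kz = K[OF z] FD[OF K(1)[OF z]]
    \<comment> \<open>If \<open>K z\<close> contained all of \<open>C1 - C2\<close>, it would differ from \<open>C2\<close> in these \<open>a\<close> vertices and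
      in \<open>z\<close>, against the choice of \<open>a\<close>.  So one of the at most \<open>a\<close> vertices of \<open>C1\<close> missed by
      \<open>K z\<close> lies outside \<open>C1 \<inter> C2\<close>.\<close>
    have "\<not> C1 - C2 \<subseteq> K z"
    proof
      assume "C1 - C2 \<subseteq> K z"
      then have "insert z (C1 - C2) \<subseteq> K z - C2" using Kz Z z by auto
      then have "card (insert z (C1 - C2)) \<le> card (K z - C2)" using Kz by (intro card_mono) auto
      moreover have "card (insert z (C1 - C2)) = Suc a"
        using Z z FD[OF C(1)] card_diff[OF C(1,2)] by (subst card_insert_disjoint) (auto simp: a_def)
      ultimately show False using widest[OF C(2) Kz(1)] by simp
    qed
    then have "C1 \<inter> C2 - K z \<subset> C1 - K z" by blast
    then have "card (C1 \<inter> C2 - K z) < card (C1 - K z)"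
      using FD[OF C(1)] by (intro psubset_card_mono) auto
    then show ?thesis using widest[OF Kz(1) C(1)] by linarith
  qed
  define M where "M = (\<Union>z\<in>Z. C1 \<inter> C2 - K z)"
  define D where "D = C1 \<inter> C2 - M"
  have "card M \<le> (\<Sum>z\<in>Z. card (C1 \<inter> C2 - K z))" unfolding M_def by (rule card_UN_le[OF Z(3)])
  also have "\<dots> \<le> (d - a) * (a - 1)" using sum_bounded_above[of Z, OF miss] Z by simp
  finally have M: "card M \<le> (d - a) * (a - 1)" .
  have "card (C1 \<inter> C2) = t - d - a"
    using card_Diff_subset_Int[of C1 C2] card_diff[OF C(1,2)] FD[OF C(1)]
      card_mono[of C1 "C1 \<inter> C2"] by (simp add: a_def)
  moreover have "card (C1 \<inter> C2) - card M \<le> card D"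
    unfolding D_def using FD[OF C(1)] Z(3) by (intro diff_card_le_card_Diff) (auto simp: M_def)
  moreover have "d + (d - a) * (a - 1) + a \<le> t - d"
    using core_bound[OF d \<open>a < d\<close>] unfolding t_def .
  ultimately have D: "d \<le> card D" using M by linarith
  define W where "W = (C2 - C1) \<union> Z"
  have finW: "finite W" using FD[OF C(2)] Z by (simp add: W_def)
  have "card W = a + (d - a)"
    unfolding W_def a_def using Z FD[OF C(2)] by (subst card_Un_disjoint) (auto simp: a_def)
  then have W: "card W = d" using \<open>a < d\<close> by simp
  obtain A where A: "A \<subseteq> pverts T" "card A = d" "parcs T `` A \<inter> A = {}"
      "card (parcs T `` A \<inter> pverts T) \<le> d"
    using one_degenerate_independent_set[OF E graph_tree_one_degenerate[OF T], of d] bounds unfolding t_def by auto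
  have DW: "D \<times> W \<subseteq> parcs G"
  proof (clarify)
    fix u w assume u: "u \<in> D" and w: "w \<in> W"
    have uC: "u \<in> C1" "u \<in> C2" using u by (auto simp: D_def)
    show "(u, w) \<in> parcs G"
    proof (cases "w \<in> Z")
      case True
      then have "u \<in> K w" "u \<noteq> w" using u uC Z by (auto simp: D_def M_def)
      then show ?thesis using clique_onD[OF FD(3)[OF K(1)[OF True]]] K(2)[OF True] by blast
    next
      case False
      then have "w \<in> C2" "w \<noteq> u" using w uC by (auto simp: W_def)
      then show ?thesis using clique_onD[OF FD(3)[OF C(2)] uC(2)] by blast
    qed
  qed
  have "D \<subseteq> C1" "W \<inter> C1 = {}" using Z by (auto simp: D_def W_def)
  moreover have "card A \<le> card W" "card (parcs T `` A \<inter> pverts T) \<le> card D"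
      "card (pverts T) \<le> card A + card C1"
    using A W D FD(2)[OF C(1)] unfolding t_def by linarith+
  ultimately have "\<exists>f. inj_on f (pverts T) \<and> f ` pverts T \<subseteq> C1 \<union> W \<and>
      (\<forall>u\<in>pverts T. \<forall>v\<in>pverts T. (u, v) \<in> parcs T \<longrightarrow> (f u, f v) \<in> parcs G)"
    using embeds_in_extended_clique[OF E(1) A(1) E(2,3) A(3) R(2) FD(5)[OF C(1)] FD(3)[OF C(1)] _ finW _ DW]
    by blast
  moreover have "C1 \<union> W \<subseteq> pverts G" using FD(1) C Z unfolding W_def by blast
  ultimately show False using graph_free_no_injection[OF pT G] by blast
qed

text \<open>
  If an edge left \<open>U\<close> at \<open>u\<close>, then a vertex of the tree with at most one neighbour could be placed on
  its other end \<open>w\<close>, that neighbour on \<open>u\<close>, and everything else on the rest of \<open>U\<close>.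
\<close>
lemma large_clique_isolated:
  assumes T: "graph_tree T" and G: "pair_graph G" "graph_free T G"
    and U: "U \<subseteq> pverts G" "clique_on (parcs G) U" "card (pverts T) = Suc (card U)"
    and uw: "(u, w) \<in> parcs G" "u \<in> U"
  shows "w \<in> U"
proof (rule ccontr)
  assume "w \<notin> U"
  have pT: "pair_graph T" using T by (simp add: graph_tree_def)
  note E = pair_graph_relation[OF pT] and R = pair_graph_relation[OF G(1)]
  have "finite U" using U(1) R(1) finite_subset by blast
  have "pverts T \<noteq> {}" using U(3) by auto
  then obtain l where l: "l \<in> pverts T" "card (parcs T `` {l} \<inter> pverts T) \<le> 1"
    using graph_tree_one_degenerate[OF T] unfolding one_degenerate_def by blast
  have "parcs T `` {l} \<inter> {l} = {}" using E(3) by (auto simp: irrefl_def)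
  then have "\<exists>f. inj_on f (pverts T) \<and> f ` pverts T \<subseteq> U \<union> {w} \<and>
      (\<forall>u\<in>pverts T. \<forall>v\<in>pverts T. (u, v) \<in> parcs T \<longrightarrow> (f u, f v) \<in> parcs G)"
    using embeds_in_extended_clique[OF E(1) _ E(2,3) _ R(2) \<open>finite U\<close> U(2), of "{l}" "{u}" "{w}"]
      l uw U(3) \<open>w \<notin> U\<close> by simp
  moreover have "w \<in> pverts G" using uw G(1)
    by (metis pair_wf_digraph.in_arcsD2 pair_fin_digraph.axioms(1) pair_digraph.axioms(1) pair_graph.axioms(1))
  ultimately show False using graph_free_no_injection[OF pT G] U(1) by blast
qed

text \<open>
  Removing \<open>v\<close> turns the cliques through \<open>v\<close> into \<open>(r - 1)\<close>-subsets of a set of at most \<open>m\<close>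
  vertices.  If all \<open>(r - 1)\<close>-subsets of an \<open>m\<close>-set arise, then, as \<open>r - 1 \<ge> 2\<close>, any two of its
  vertices lie in a common clique.
\<close>
lemma card_cliques_at_vertex:
  assumes G: "pair_graph G"
    and span: "card (\<Union>{C \<in> cliques r G. v \<in> C}) \<le> Suc m"
  shows "card {C \<in> cliques r G. v \<in> C} \<le> m choose (r - 1)"
    and "card {C \<in> cliques r G. v \<in> C} = m choose (r - 1) \<Longrightarrow> 3 \<le> r \<Longrightarrow> r \<le> Suc m \<Longrightarrow>
      \<exists>U\<subseteq>pverts G. card U = Suc m \<and> clique_on (parcs G) U"
proof -
  define F where "F = {C \<in> cliques r G. v \<in> C}"
  define U where "U = \<Union>F"
  define S where "S = {B. B \<subseteq> U - {v} \<and> card B = r - 1}"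
  have FD: "C \<subseteq> pverts G" "card C = r" "clique_on (parcs G) C" "v \<in> C" if "C \<in> F" for C
    using that cliquesD[of C r G] by (auto simp: F_def)
  have U: "U \<subseteq> pverts G" using FD(1) by (auto simp: U_def)
  then have finU: "finite U" using pair_graph_relation(1)[OF G] finite_subset by blast
  have "F \<subseteq> insert v ` S"
  proof
    fix C assume C: "C \<in> F"
    have "C - {v} \<in> S" using FD[OF C] C finU by (auto simp: S_def U_def card_Diff_singleton)
    then show "C \<in> insert v ` S" using FD(4)[OF C] by (metis imageI insert_Diff)
  qed
  have "finite S" unfolding S_def using finU by simp
  have cS: "card S = card (U - {v}) choose (r - 1)"
    unfolding S_def using finU by (intro n_subsets) simp
  have FS: "card F \<le> card S"
    using \<open>F \<subseteq> insert v ` S\<close> \<open>finite S\<close> by (meson card_image_le card_mono finite_imageI le_trans)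
  have vU: "v \<in> U" if "F \<noteq> {}" using that FD(4) by (auto simp: U_def)
  have "card U \<le> Suc m" using span by (simp add: U_def F_def)
  then have cU: "card (U - {v}) \<le> m" if "F \<noteq> {}"
    using card_Diff_singleton[OF vU[OF that]] by simp
  show "card {C \<in> cliques r G. v \<in> C} \<le> m choose (r - 1)"
  proof (cases "F = {}")
    case False
    then show ?thesis using FS cS binomial_right_mono[OF cU, of "r - 1"] unfolding F_def by linarith
  next
    case True
    then have "card F = 0" by simp
    then show ?thesis unfolding F_def by linarith
  qed
  show "\<exists>U\<subseteq>pverts G. card U = Suc m \<and> clique_on (parcs G) U"
    if eq: "card {C \<in> cliques r G. v \<in> C} = m choose (r - 1)" and r3: "3 \<le> r" and rm: "r \<le> Suc m"
  proof -
    have "0 < card F" using eq rm unfolding F_def by simp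
    then have "F \<noteq> {}" by auto
    have "card (U - {v}) = m"
    proof (rule ccontr)
      assume "card (U - {v}) \<noteq> m"
      then obtain m' where m: "m = Suc m'" "card (U - {v}) \<le> m'"
        using cU[OF \<open>F \<noteq> {}\<close>] by (cases m) auto
      have "card S \<le> m' choose (r - 1)" using cS binomial_right_mono[OF m(2)] by simp
      moreover have "m choose (r - 1) = (m' choose (r - 1 - 1)) + (m' choose (r - 1))"
        using r3 unfolding m(1) by (cases "r - 1") auto
      moreover have "0 < m' choose (r - 1 - 1)" using rm r3 m(1) by simp
      ultimately show False using FS eq unfolding F_def by linarith
    qed
    then have "card U = Suc m" using card_Suc_Diff1[OF finU vU[OF \<open>F \<noteq> {}\<close>]] by simp
    have "F = insert v ` S"
      using \<open>F \<subseteq> insert v ` S\<close> \<open>finite S\<close> eq cS \<open>card (U - {v}) = m\<close> card_image_le[of S "insert v"]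
      by (intro card_seteq) (auto simp: F_def)
    have "clique_on (parcs G) U"
      unfolding clique_on_def
    proof (intro ballI impI)
      fix x y assume xy: "x \<in> U" "y \<in> U" "x \<noteq> y"
      have "card ({x, y} - {v}) \<le> card {x, y}" by (intro card_mono) auto
      then have "card ({x, y} - {v}) \<le> r - 1" using r3 xy by simp
      moreover have "r - 1 \<le> card (U - {v})" using rm \<open>card (U - {v}) = m\<close> by simp
      moreover have "{x, y} - {v} \<subseteq> U - {v}" using xy by blast
      moreover have "finite (U - {v})" using finU by simp
      ultimately obtain B where B: "{x, y} - {v} \<subseteq> B" "B \<subseteq> U - {v}" "card B = r - 1"
        using exists_subset_between by meson
      then have "insert v B \<in> F" unfolding \<open>F = insert v ` S\<close> S_def by blast
      moreover have "x \<in> insert v B" "y \<in> insert v B" using B(1) by blast+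
      ultimately show "(x, y) \<in> parcs G" using clique_onD[OF FD(3)] xy(3) by simp
    qed
    then show ?thesis using U \<open>card U = Suc m\<close> by blast
  qed
qed

section \<open>Eigenvalues of the clique tensor\<close>

text \<open>
  A clique \<open>C\<close> through \<open>i\<close> contributes once for each of the \<open>(r - 1)!\<close> orderings of \<open>C - {i}\<close>, which
  the entry \<open>1 / (r - 1)!\<close> of the tensor cancels.
\<close>
lemma clique_tensor_row:
  fixes x :: "'a \<Rightarrow> complex"
  assumes G: "finite (pverts G)" and i: "i \<in> pverts G" and r: "1 \<le> r"
  shows "(\<Sum>js | set js \<subseteq> pverts G \<and> length js = r - 1.
            complex_of_real (clique_tensor r G (i # js)) * prod_list (map x js))
       = (\<Sum>C | C \<in> cliques r G \<and> i \<in> C. \<Prod>j\<in>C - {i}. x j)"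
proof -
  define L where "L = {js. set js \<subseteq> pverts G \<and> length js = r - 1}"
  define F where "F = {C. C \<in> cliques r G \<and> i \<in> C}"
  define h where "h = (\<lambda>js. complex_of_real (clique_tensor r G (i # js)) * prod_list (map x js))"
  define J where "J = (\<Union>C\<in>F. permutations_of_set (C - {i}))"
  have FD: "C \<subseteq> pverts G" "card C = r" "i \<in> C" "C \<in> cliques r G" "finite C" if "C \<in> F" for C
    using that cliquesD[of C r G] G finite_subset[of C "pverts G"] by (auto simp: F_def)
  have "finite F" using FD(1) G by (intro finite_subset[of F "Pow (pverts G)"]) auto
  have "finite L" unfolding L_def using G by (rule finite_lists_length_eq)
  have JL: "J \<subseteq> L"
  proof
    fix js assume "js \<in> J"
    then obtain C where C: "C \<in> F" "js \<in> permutations_of_set (C - {i})" by (auto simp: J_def)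
    then have "length js = r - 1" "set js = C - {i}"
      using length_finite_permutations_of_set[OF C(2)] FD[OF C(1)] permutations_of_setD(1)[OF C(2)]
      by (auto simp: card_Diff_singleton)
    then show "js \<in> L" using FD(1)[OF C(1)] by (auto simp: L_def)
  qed
  have zero: "h js = 0" if "js \<in> L - J" for js
  proof (rule ccontr)
    assume "h js \<noteq> 0"
    then have C: "set (i # js) \<in> cliques r G" "length (i # js) = r"
      by (auto simp: h_def clique_tensor_def split: if_splits)
    \<comment> \<open>A list of length \<open>r\<close> whose set of entries has \<open>r\<close> elements has no repetition.\<close>
    then have "distinct (i # js)" using cliquesD(2)[OF C(1)] by (intro card_distinct) simp
    then have "js \<in> permutations_of_set (set (i # js) - {i})" by (intro permutations_of_setI) auto
    then have "js \<in> J" using C unfolding J_def F_def by (intro UN_I[of "set (i # js)"]) auto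
    then show False using that by simp
  qed
  have "sum h L = sum h J" using zero JL \<open>finite L\<close> by (intro sum.mono_neutral_right) auto
  also have "\<dots> = (\<Sum>C\<in>F. sum h (permutations_of_set (C - {i})))"
    unfolding J_def
  proof (rule sum.UNION_disjoint[OF \<open>finite F\<close>])
    show "\<forall>C\<in>F. \<forall>C'\<in>F. C \<noteq> C' \<longrightarrow>
        permutations_of_set (C - {i}) \<inter> permutations_of_set (C' - {i}) = {}"
    proof (intro ballI impI equals0I)
      fix C C' js assume C: "C \<in> F" "C' \<in> F" "C \<noteq> C'"
        and "js \<in> permutations_of_set (C - {i}) \<inter> permutations_of_set (C' - {i})"
      then have "C - {i} = C' - {i}" using permutations_of_setD(1) by blast
      then show False using FD(3)[OF C(1)] FD(3)[OF C(2)] C(3) by blast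
    qed
  qed simp
  also have "\<dots> = (\<Sum>C\<in>F. \<Prod>j\<in>C - {i}. x j)"
  proof (rule sum.cong[OF refl])
    fix C assume C: "C \<in> F"
    note CD = FD[OF C]
    have card: "card (C - {i}) = r - 1" using CD by (simp add: card_Diff_singleton)
    have "h js = (1 / fact (r - 1)) * (\<Prod>j\<in>C - {i}. x j)"
      if js: "js \<in> permutations_of_set (C - {i})" for js
    proof -
      have jsD: "set js = C - {i}" "distinct js" using permutations_of_setD[OF js] .
      have "length (i # js) = r" using length_finite_permutations_of_set[OF js] card r by simp
      moreover have "set (i # js) = C" using jsD CD by auto
      ultimately have "clique_tensor r G (i # js) = 1 / fact (r - 1)"
        unfolding clique_tensor_def using CD(4) by simp
      moreover have "prod_list (map x js) = (\<Prod>j\<in>C - {i}. x j)"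
        using prod.distinct_set_conv_list[OF jsD(2), of x] jsD(1) by simp
      ultimately show ?thesis unfolding h_def by simp
    qed
    then have "sum h (permutations_of_set (C - {i}))
        = (\<Sum>js\<in>permutations_of_set (C - {i}). (1 / fact (r - 1)) * (\<Prod>j\<in>C - {i}. x j))"
      by (rule sum.cong[OF refl])
    also have "\<dots> = (\<Prod>j\<in>C - {i}. x j)"
      using CD(5) card by simp
    finally show "sum h (permutations_of_set (C - {i})) = (\<Prod>j\<in>C - {i}. x j)" .
  qed
  finally show ?thesis unfolding h_def L_def F_def .
qed

text \<open>
  Compare the moduli of both sides of the eigenvalue equation at an index \<open>i\<close> where \<open>x\<close> has
  largest modulus \<open>m\<close>: every clique through \<open>i\<close> contributes at most \<open>m ^ (r - 1)\<close>.
\<close>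
lemma eigenvalue_le_clique_degree:
  assumes G: "finite (pverts G)" and r: "1 \<le> r"
    and z: "tensor_eigenvalue r (pverts G) (clique_tensor r G) z"
  shows "\<exists>i\<in>pverts G. cmod z \<le> real (card {C. C \<in> cliques r G \<and> i \<in> C})"
proof -
  obtain x where x: "\<exists>i\<in>pverts G. x i \<noteq> 0"
    and x_eq: "\<forall>i\<in>pverts G. (\<Sum>js | set js \<subseteq> pverts G \<and> length js = r - 1.
      complex_of_real (clique_tensor r G (i # js)) * prod_list (map x js)) = z * x i ^ (r - 1)"
    using z unfolding tensor_eigenvalue_def by blast
  have eq: "(\<Sum>C | C \<in> cliques r G \<and> i \<in> C. \<Prod>j\<in>C - {i}. x j) = z * x i ^ (r - 1)"
    if "i \<in> pverts G" for i
    using x_eq that clique_tensor_row[OF G that r, of x] by simp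
  define m where "m = Max ((\<lambda>i. cmod (x i)) ` pverts G)"
  have "pverts G \<noteq> {}" using x by auto
  then obtain i where i: "i \<in> pverts G" "cmod (x i) = m"
    using Max_in[of "(\<lambda>i. cmod (x i)) ` pverts G"] G unfolding m_def by fastforce
  have max: "cmod (x j) \<le> m" if "j \<in> pverts G" for j
    unfolding m_def using that G by (intro Max_ge) auto
  have "0 < m" using x max by (metis norm_le_zero_iff not_le order_trans)
  have "cmod z * m ^ (r - 1) = cmod (\<Sum>C | C \<in> cliques r G \<and> i \<in> C. \<Prod>j\<in>C - {i}. x j)"
    unfolding eq[OF i(1)] by (simp add: norm_mult norm_power i(2))
  also have "\<dots> \<le> (\<Sum>C | C \<in> cliques r G \<and> i \<in> C. m ^ (r - 1))"
  proof (rule sum_norm_le)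
    fix C assume "C \<in> {C. C \<in> cliques r G \<and> i \<in> C}"
    then have C: "C \<subseteq> pverts G" "card C = r" "i \<in> C" using cliquesD[of C r G] by auto
    have "cmod (\<Prod>j\<in>C - {i}. x j) = (\<Prod>j\<in>C - {i}. cmod (x j))" by (simp add: prod_norm)
    also have "\<dots> \<le> (\<Prod>j\<in>C - {i}. m)" using max C(1) by (intro prod_mono) auto
    also have "\<dots> = m ^ (r - 1)" using C finite_subset[OF C(1) G] by (simp add: card_Diff_singleton)
    finally show "cmod (\<Prod>j\<in>C - {i}. x j) \<le> m ^ (r - 1)" .
  qed
  also have "\<dots> = real (card {C. C \<in> cliques r G \<and> i \<in> C}) * m ^ (r - 1)" by simp
  finally show ?thesis using i(1) \<open>0 < m\<close> by (auto simp: mult_le_cancel_right)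
qed

lemma clique_spectral_radius_le:
  assumes "finite (pverts G)" "1 \<le> r" "0 \<le> b"
    and "\<And>i. i \<in> pverts G \<Longrightarrow> real (card {C \<in> cliques r G. i \<in> C}) \<le> b"
  shows "clique_spectral_radius r G \<le> b"
  unfolding clique_spectral_radius_def tensor_spectral_radius_def
  using eigenvalue_le_clique_degree[OF assms(1,2)] assms(3,4)
  by (intro cSup_least) (auto intro: order_trans)

text \<open>
  The definition takes a supremum of reals, so the content is that the moduli of the eigenvalues are
  bounded; the number of all cliques is a bound.
\<close>
lemma clique_spectral_radius_ge:
  assumes "finite (pverts G)" "1 \<le> r" "tensor_eigenvalue r (pverts G) (clique_tensor r G) z"
  shows "cmod z \<le> clique_spectral_radius r G"
  unfolding clique_spectral_radius_def tensor_spectral_radius_def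
proof (rule cSup_upper)
  have "finite (cliques r G)"
    using assms(1) cliquesD(1) by (intro finite_subset[of "cliques r G" "Pow (pverts G)"]) auto
  then have "card {C \<in> cliques r G. i \<in> C} \<le> card (cliques r G)" for i by (intro card_mono) auto
  then have "cmod y \<le> real (card (cliques r G))"
    if "tensor_eigenvalue r (pverts G) (clique_tensor r G) y" for y
    using eigenvalue_le_clique_degree[OF assms(1,2) that] by (meson of_nat_mono order_trans)
  then show "bdd_above (insert 0 {cmod z |z. tensor_eigenvalue r (pverts G) (clique_tensor r G) z})"
    by (intro bdd_aboveI[of _ "real (card (cliques r G))"]) auto
qed (use assms(3) in auto)

definition isolated_clique :: "'a pair_pre_digraph \<Rightarrow> 'a set \<Rightarrow> bool" where
  "isolated_clique G U \<longleftrightarrow> U \<subseteq> pverts G \<and> clique_on (parcs G) U \<and>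
     (\<forall>u v. (u, v) \<in> parcs G \<longrightarrow> (u \<in> U \<longleftrightarrow> v \<in> U))"

text \<open>
  The indicator vector of \<open>U\<close> is an eigenvector.  Since no edge leaves \<open>U\<close>, a clique lies inside \<open>U\<close>
  or misses it: an index in \<open>U\<close> counts the \<open>r\<close>-subsets of \<open>U\<close> that contain it, and at any other
  index all products vanish because \<open>r \<ge> 2\<close> leaves at least one factor.
\<close>
lemma clique_spectral_radius_isolated_clique:
  assumes G: "finite (pverts G)" and r: "2 \<le> r"
    and U: "isolated_clique G U" "card U = Suc m"
  shows "real (m choose (r - 1)) \<le> clique_spectral_radius r G"
proof -
  define x where "x = (\<lambda>i. if i \<in> U then 1 else 0 :: complex)"
  have UG: "U \<subseteq> pverts G" and clique: "clique_on (parcs G) U"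
    and iso: "\<And>u v. (u, v) \<in> parcs G \<Longrightarrow> u \<in> U \<longleftrightarrow> v \<in> U"
    using U(1) by (auto simp: isolated_clique_def)
  have "finite U" using UG G finite_subset by blast
  have side: "C \<subseteq> U \<longleftrightarrow> i \<in> U" "C \<inter> U = {} \<longleftrightarrow> i \<notin> U" if "C \<in> cliques r G" "i \<in> C" for C i
    using clique_onD[OF cliquesD(3)[OF that(1)] that(2)] iso that(2) by blast+
  have count: "card {C. C \<in> cliques r G \<and> i \<in> C} = m choose (r - 1)" if i: "i \<in> U" for i
  proof -
    define S where "S = {B. B \<subseteq> U - {i} \<and> card B = r - 1}"
    have "{C. C \<in> cliques r G \<and> i \<in> C} = insert i ` S"
    proof (intro equalityI subsetI)
      fix C assume "C \<in> {C. C \<in> cliques r G \<and> i \<in> C}"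
      then have C: "C \<in> cliques r G" "i \<in> C" by auto
      have "C - {i} \<in> S"
        using side(1)[OF C] i cliquesD(2)[OF C(1)] C(2) by (auto simp: S_def card_Diff_singleton)
      then show "C \<in> insert i ` S" using C(2) by (metis imageI insert_Diff)
    next
      fix C assume "C \<in> insert i ` S"
      then obtain B where B: "C = insert i B" "B \<subseteq> U - {i}" "card B = r - 1" by (auto simp: S_def)
      have "finite B" using B(2) \<open>finite U\<close> finite_subset by blast
      then have "card C = r" using B r by (simp add: card_insert_if subset_Diff_insert)
      moreover have "C \<subseteq> U" using B i by blast
      ultimately show "C \<in> {C. C \<in> cliques r G \<and> i \<in> C}"
        using UG clique B(1) unfolding cliques_def clique_on_def by blast
    qed
    moreover have "inj_on (insert i) S" by (rule inj_onI) (auto simp: S_def)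
    moreover have "card S = m choose (r - 1)"
      unfolding S_def using \<open>finite U\<close> U(2) i n_subsets[of "U - {i}" "r - 1"]
      by (simp add: card_Diff_singleton)
    ultimately show ?thesis by (simp add: card_image)
  qed
  have "tensor_eigenvalue r (pverts G) (clique_tensor r G) (of_nat (m choose (r - 1)))"
    unfolding tensor_eigenvalue_def
  proof (intro exI[of _ x] conjI ballI)
    have "U \<noteq> {}" using U(2) by auto
    then show "\<exists>i\<in>pverts G. x i \<noteq> 0" using UG by (auto simp: x_def)
  next
    fix i assume i: "i \<in> pverts G"
    have "(\<Sum>C | C \<in> cliques r G \<and> i \<in> C. \<Prod>j\<in>C - {i}. x j) = of_nat (m choose (r - 1)) * x i ^ (r - 1)"
    proof (cases "i \<in> U")
      case True
      have "(\<Prod>j\<in>C - {i}. x j) = 1" if "C \<in> cliques r G" "i \<in> C" for C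
        using side(1)[OF that] True by (intro prod.neutral) (auto simp: x_def)
      then show ?thesis using True count[OF True] by (simp add: x_def)
    next
      case False
      have "(\<Prod>j\<in>C - {i}. x j) = 0" if C: "C \<in> cliques r G" "i \<in> C" for C
      proof -
        have "card (C - {i}) = r - 1" using cliquesD(2)[OF C(1)] C(2) by (simp add: card_Diff_singleton)
        then have "0 < card (C - {i})" using r by simp
        then have "C - {i} \<noteq> {}" "finite (C - {i})" unfolding card_gt_0_iff by simp_all
        moreover from this obtain j where j: "j \<in> C - {i}" by blast
        moreover have "x j = 0" using side(2)[OF C] False j unfolding x_def by auto
        ultimately show ?thesis by (intro prod_zero) auto
      qed
      then show ?thesis using False r by (simp add: x_def)
    qed
    then show "(\<Sum>js | set js \<subseteq> pverts G \<and> length js = r - 1.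
        complex_of_real (clique_tensor r G (i # js)) * prod_list (map x js))
        = of_nat (m choose (r - 1)) * x i ^ (r - 1)"
      using clique_tensor_row[OF G i, of r x] r by simp
  qed
  then have "cmod (of_nat (m choose (r - 1))) \<le> clique_spectral_radius r G"
    using r by (intro clique_spectral_radius_ge[OF G]) simp_all
  then show ?thesis unfolding norm_of_nat .
qed

section \<open>Isolated complete subgraphs\<close>

text \<open>
  For \<open>H\<close> take the subgraph induced outside \<open>U\<close>, which inherits freeness from \<open>G\<close>.
\<close>
lemma isolated_clique_disjoint_union:
  fixes G :: "'a pair_pre_digraph" and T :: "'b pair_pre_digraph"
  assumes G: "pair_graph G" "graph_free T G" and U: "isolated_clique G U" "card U = m"
  shows "\<exists>H :: 'a pair_pre_digraph. pair_graph H \<and> graph_free T H \<and>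
    digraph_iso (with_proj G) (with_proj (disjoint_union (complete_graph m) H))"
proof -
  interpret G: pair_graph G by fact
  have UG: "U \<subseteq> pverts G" and clique: "clique_on (parcs G) U"
    and iso: "\<And>u v. (u, v) \<in> parcs G \<Longrightarrow> u \<in> U \<longleftrightarrow> v \<in> U"
    using U(1) by (auto simp: isolated_clique_def)
  define H where "H = \<lparr>pverts = pverts G - U, parcs = {(u, v) \<in> parcs G. u \<notin> U \<and> v \<notin> U}\<rparr>"
  have H: "pair_graph H"
  proof
    show "\<And>e. e \<in> parcs H \<Longrightarrow> fst e \<in> pverts H" "\<And>e. e \<in> parcs H \<Longrightarrow> snd e \<in> pverts H"
      using G.wellformed' by (auto simp: H_def)
    show "finite (pverts H)" "finite (parcs H)"
      using G.pair_finite_verts G.pair_finite_arcs finite_subset[of "parcs H" "parcs G"]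
      by (auto simp: H_def)
    show "\<And>e. e \<in> parcs H \<Longrightarrow> fst e \<noteq> snd e"
      using G.no_loops' by (auto simp: H_def)
    show "symmetric (with_proj H)"
      using G.arcs_symmetric by (auto simp: symmetric_def H_def intro: symI)
  qed
  then interpret H: pair_graph H .
  have HG: "subgraph (with_proj H) (with_proj G)"
    using G.wf_digraph H.wf_digraph by (auto simp: subgraph_def compatible_def H_def)
  have free: "graph_free T H"
    using G(2) subgraph_trans[OF HG] unfolding graph_free_def by (metis HG subgraph_trans)
  have "finite U" using UG G.pair_finite_verts finite_subset by blast
  then obtain g where g: "bij_betw g U {..<m}"
    using U(2) ex_bij_betw_finite_nat atLeast0LessThan by metis
  define f where "f = (\<lambda>v. if v \<in> U then Inl (g v) else Inr v)"
  define h where "h = \<lparr>iso_verts = f, iso_arcs = map_prod f f, iso_head = snd, iso_tail = fst\<rparr>"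
  have inj: "inj_on f (pverts G)"
    using g by (auto simp: f_def inj_on_def bij_betw_def)
  have "inj_on (map_prod f f) (parcs G)"
    by (rule inj_on_subset[OF map_prod_inj_on[OF inj inj]]) (use G.wellformed' in auto)
  then have "G.digraph_isomorphism h"
    using inj by (simp add: G.digraph_isomorphism_def h_def G.wf_digraph)
  moreover have "f ` pverts G = {..<m} <+> (pverts G - U)"
  proof -
    have "f ` pverts G = f ` U \<union> f ` (pverts G - U)" using UG by blast
    also have "f ` U = Inl ` g ` U" by (auto simp: f_def)
    also have "f ` (pverts G - U) = Inr ` (pverts G - U)" by (auto simp: f_def)
    finally show ?thesis using g by (simp add: bij_betw_def Plus_def)
  qed
  moreover have "map_prod f f ` parcs G =
      map_prod Inl Inl ` {(u, v). u < m \<and> v < m \<and> u \<noteq> v} \<union> map_prod Inr Inr ` parcs H"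
  proof (intro equalityI subsetI)
    fix e assume "e \<in> map_prod f f ` parcs G"
    then obtain u v where e: "e = (f u, f v)" "(u, v) \<in> parcs G" by auto
    show "e \<in> map_prod Inl Inl ` {(u, v). u < m \<and> v < m \<and> u \<noteq> v} \<union> map_prod Inr Inr ` parcs H"
    proof (cases "u \<in> U")
      case True
      then have "v \<in> U" "u \<noteq> v" using iso e G.no_loops' by blast+
      then have "g u < m" "g v < m" "g u \<noteq> g v" using g True by (auto simp: bij_betw_def inj_on_def)
      then show ?thesis using e True \<open>v \<in> U\<close> by (auto simp: f_def)
    next
      case False
      then have "v \<notin> U" using iso e by blast
      then show ?thesis using e False by (auto simp: f_def H_def)
    qed
  next
    fix e assume "e \<in> map_prod Inl Inl ` {(u, v). u < m \<and> v < m \<and> u \<noteq> v} \<union> map_prod Inr Inr ` parcs H"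
    then consider a b where "e = (Inl a, Inl b)" "a < m" "b < m" "a \<noteq> b"
      | u v where "e = (Inr u, Inr v)" "(u, v) \<in> parcs H" by auto
    then show "e \<in> map_prod f f ` parcs G"
    proof cases
      case 1
      have "a \<in> g ` U" "b \<in> g ` U" using 1 g by (auto simp: bij_betw_def)
      then obtain u v where uv: "u \<in> U" "g u = a" "v \<in> U" "g v = b" by blast
      then have "(u, v) \<in> parcs G" using 1 clique_onD[OF clique] by blast
      moreover have "e = map_prod f f (u, v)" using 1 uv by (simp add: f_def)
      ultimately show ?thesis by blast
    next
      case 2
      then have "e = map_prod f f (u, v)" "(u, v) \<in> parcs G" by (auto simp: f_def H_def)
      then show ?thesis by blast
    qed
  qed
  ultimately have "digraph_iso (with_proj G) (with_proj (disjoint_union (complete_graph m) H))"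
    unfolding digraph_iso_def
    by (intro exI[of _ h])
      (simp add: app_iso_def h_def with_proj_def disjoint_union_def complete_graph_def H_def)
  then show ?thesis using H free by blast
qed

text \<open>
  The preimage of the left summand under the isomorphism is the required clique.  As an isomorphism
  into a graph whose arcs are pairs must respect the projections to both ends, it maps the arc
  \<open>(u, v)\<close> to the pair of the images of \<open>u\<close> and \<open>v\<close>.
\<close>
lemma disjoint_union_isolated_clique:
  fixes G :: "'a pair_pre_digraph" and H :: "'b pair_pre_digraph"
  assumes G: "pair_graph G"
    and iso: "digraph_iso (with_proj G) (with_proj (disjoint_union (complete_graph m) H))"
  shows "\<exists>U. isolated_clique G U \<and> card U = m"
proof -
  interpret G: pair_graph G by fact
  obtain h where h: "G.digraph_isomorphism h"
      "with_proj (disjoint_union (complete_graph m) H) = app_iso h (with_proj G)"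
    using iso unfolding digraph_iso_def by blast
  define f where "f = iso_verts h"
  have inj: "inj_on f (pverts G)" using h(1) by (simp add: f_def G.digraph_isomorphism_def)
  have verts: "f ` pverts G = {..<m} <+> pverts H"
    using arg_cong[OF h(2), of verts] by (simp add: f_def disjoint_union_def complete_graph_def)
  have ends: "iso_tail h = fst" "iso_head h = snd"
    using arg_cong[OF h(2), of tail] arg_cong[OF h(2), of head] by simp_all
  have "iso_arcs h e = map_prod f f e" if "e \<in> parcs G" for e
    using h(1) that ends by (auto simp: G.digraph_isomorphism_def f_def prod_eq_iff)
  then have "iso_arcs h ` parcs G = map_prod f f ` parcs G" by (rule image_cong[OF refl])
  then have arcs: "map_prod f f ` parcs G =
      map_prod Inl Inl ` {(u, v). u < m \<and> v < m \<and> u \<noteq> v} \<union> map_prod Inr Inr ` parcs H"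
    using arg_cong[OF h(2), of arcs] by (simp add: disjoint_union_def complete_graph_def)
  define U where "U = {v \<in> pverts G. f v \<in> range Inl}"
  have UG: "U \<subseteq> pverts G" by (auto simp: U_def)
  let ?I = "Inl ` {..<m} :: (nat + 'b) set"
  have fU: "f ` U = ?I"
  proof
    show "f ` U \<subseteq> ?I" using verts by (auto simp: U_def Plus_def)
    show "?I \<subseteq> f ` U"
    proof
      fix y assume y: "y \<in> ?I"
      then have "y \<in> f ` pverts G" unfolding verts by auto
      then show "y \<in> f ` U" using y by (auto simp: U_def)
    qed
  qed
  then have "card (f ` U) = m" by (simp add: card_image)
  then have "card U = m" using card_image[OF inj_on_subset[OF inj UG]] by simp
  moreover have "clique_on (parcs G) U"
    unfolding clique_on_def
  proof (intro ballI impI)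
    fix u v assume uv: "u \<in> U" "v \<in> U" "u \<noteq> v"
    then have "f u \<noteq> f v" using inj UG by (auto dest: inj_onD)
    moreover have "f u \<in> ?I" "f v \<in> ?I"
      using uv fU by blast+
    ultimately have "(f u, f v) \<in> map_prod Inl Inl ` {(u, v). u < m \<and> v < m \<and> u \<noteq> v}"
      by auto
    then have "(f u, f v) \<in> map_prod f f ` parcs G" unfolding arcs by blast
    then obtain u' v' where "(u', v') \<in> parcs G" "f u = f u'" "f v = f v'" by auto
    then show "(u, v) \<in> parcs G"
      using inj_onD[OF inj] uv(1,2) UG G.wellformed' by (metis subsetD)
  qed
  moreover have "u \<in> U \<longleftrightarrow> v \<in> U" if uv: "(u, v) \<in> parcs G" for u v
  proof -
    have "(f u, f v) \<in> map_prod f f ` parcs G" using uv by force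
    then have "f u \<in> range Inl \<longleftrightarrow> f v \<in> range Inl" unfolding arcs by auto
    then show ?thesis using uv G.wellformed' by (auto simp: U_def)
  qed
  ultimately show ?thesis using UG by (auto simp: isolated_clique_def)
qed

lemma pair_graph_complete_graph: "pair_graph (complete_graph m)"
proof
  show "finite (pverts (complete_graph m))" "finite (parcs (complete_graph m))"
    by (auto simp: complete_graph_def intro: finite_subset[of _ "{..<m} \<times> {..<m}"])
  show "symmetric (with_proj (complete_graph m))"
    by (auto simp: symmetric_def complete_graph_def intro: symI)
qed (auto simp: complete_graph_def)

lemma clique_spectral_radius_complete_graph:
  assumes "2 \<le> r"
  shows "clique_spectral_radius r (complete_graph (Suc m)) = real (m choose (r - 1))"
proof (rule antisym)
  let ?K = "complete_graph (Suc m)"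
  have fin: "finite (pverts ?K)" by (simp add: complete_graph_def)
  have "card (\<Union>{C \<in> cliques r ?K. v \<in> C}) \<le> Suc m" for v
  proof -
    have "\<Union>{C \<in> cliques r ?K. v \<in> C} \<subseteq> {..<Suc m}" by (auto simp: cliques_def complete_graph_def)
    then show ?thesis using card_mono[of "{..<Suc m}"] by fastforce
  qed
  then show "clique_spectral_radius r ?K \<le> real (m choose (r - 1))"
    using assms fin card_cliques_at_vertex(1)[OF pair_graph_complete_graph]
    by (intro clique_spectral_radius_le) auto
  have "isolated_clique ?K {..<Suc m}"
    by (auto simp: isolated_clique_def clique_on_def complete_graph_def)
  then show "real (m choose (r - 1)) \<le> clique_spectral_radius r ?K"
    using clique_spectral_radius_isolated_clique[OF fin assms] by simp
qed

theorem theorem1p10: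
  fixes d t :: nat
    and T :: "'b pair_pre_digraph"
    and G :: "'a pair_pre_digraph"
  assumes "d \<ge> 2" and "t \<ge> d ^ 2 - d + 3"
    and "graph_tree T" and "card (pverts T) = t"
    and "pair_graph G" and "graph_free T G"
  shows "clique_spectral_radius (t - d) G \<le> clique_spectral_radius (t - d) (complete_graph (t - 1))
    \<and> clique_spectral_radius (t - d) (complete_graph (t - 1)) = real ((t - 2) choose (t - d - 1))
    \<and> (t - 2) choose (t - d - 1) = (t - 2) choose (d - 1)
    \<and> (card (pverts G) \<ge> t - 1 \<longrightarrow>
        (clique_spectral_radius (t - d) G = clique_spectral_radius (t - d) (complete_graph (t - 1))
         \<longleftrightarrow> (\<exists>H :: 'a pair_pre_digraph. pair_graph H \<and> graph_free T H \<and>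
                digraph_iso (with_proj G) (with_proj (disjoint_union (complete_graph (t - 1)) H)))))"
proof -
  define r where "r = t - d"
  define m where "m = t - 2"
  define \<Delta> where "\<Delta> = m choose (r - 1)"
  note bounds = tree_size_bounds[OF assms(1,2)]
  have r: "3 \<le> r" "r \<le> Suc m" "2 \<le> r" "1 \<le> r" and m: "t - 1 = Suc m" "t = Suc (Suc m)"
    using bounds assms(1) unfolding r_def m_def by linarith+
  note fin = pair_graph_relation(1)[OF assms(5)]
  have span: "card (\<Union>{C \<in> cliques r G. v \<in> C}) \<le> Suc m" for v
    using cliques_at_vertex_span[OF assms(1) _ assms(3,5,6), of v] assms(2) m(2)
    unfolding r_def assms(4) by linarith
  note degree = card_cliques_at_vertex[OF assms(5) span, folded \<Delta>_def]
  have upper: "clique_spectral_radius r G \<le> real \<Delta>"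
    using degree(1) by (intro clique_spectral_radius_le[OF fin r(4)]) auto
  have complete: "clique_spectral_radius r (complete_graph (t - 1)) = real \<Delta>"
    unfolding m(1) \<Delta>_def by (rule clique_spectral_radius_complete_graph[OF r(3)])
  have symmetry: "m choose (r - 1) = m choose (d - 1)"
    using binomial_symmetric[of "d - 1" m] bounds assms(1) by (simp add: r_def m_def)
  have isolated: "\<exists>U. isolated_clique G U \<and> card U = Suc m" if eq: "clique_spectral_radius r G = real \<Delta>"
  proof -
    have "0 < \<Delta>" using r by (simp add: \<Delta>_def)
    \<comment> \<open>The clique counts are integers, so if all were below \<open>\<Delta>\<close>, the spectral radius would be at
      most \<open>\<Delta> - 1\<close>.\<close>
    have "\<exists>v. card {C \<in> cliques r G. v \<in> C} = \<Delta>"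
    proof (rule ccontr)
      assume "\<not> ?thesis"
      then have "card {C \<in> cliques r G. v \<in> C} \<noteq> \<Delta>" for v by blast
      then have "card {C \<in> cliques r G. v \<in> C} < \<Delta>" for v
        using degree(1)[of v] by (simp add: order_less_le)
      then have "real (card {C \<in> cliques r G. v \<in> C}) \<le> real (\<Delta> - 1)" for v
        by (metis One_nat_def Suc_leI Suc_pred \<open>0 < \<Delta>\<close> less_Suc_eq_le of_nat_mono)
      then have "clique_spectral_radius r G \<le> real (\<Delta> - 1)"
        by (intro clique_spectral_radius_le[OF fin r(4)]) simp_all
      then show False using eq \<open>0 < \<Delta>\<close> by simp
    qed
    then obtain v where "card {C \<in> cliques r G. v \<in> C} = \<Delta>" by blast
    from degree(2)[OF this r(1,2)] obtain U
      where U: "U \<subseteq> pverts G" "card U = Suc m" "clique_on (parcs G) U" by blast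
    have "v \<in> U" if "(u, v) \<in> parcs G" "u \<in> U" for u v
      using large_clique_isolated[OF assms(3,5,6) U(1,3) _ that] U(2) m(2) assms(4) by simp
    then have "u \<in> U \<longleftrightarrow> v \<in> U" if "(u, v) \<in> parcs G" for u v
      using that symD[OF pair_graph_relation(2)[OF assms(5)] that] by blast
    then show ?thesis using U by (auto simp: isolated_clique_def)
  qed
  have "clique_spectral_radius r G = real \<Delta> \<longleftrightarrow> (\<exists>H :: 'a pair_pre_digraph. pair_graph H \<and>
      graph_free T H \<and> digraph_iso (with_proj G) (with_proj (disjoint_union (complete_graph (t - 1)) H)))"
  proof
    assume "clique_spectral_radius r G = real \<Delta>"
    then show "\<exists>H :: 'a pair_pre_digraph. pair_graph H \<and> graph_free T H \<and>
        digraph_iso (with_proj G) (with_proj (disjoint_union (complete_graph (t - 1)) H))"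
      using isolated isolated_clique_disjoint_union[OF assms(5,6)] unfolding m(1) by blast
  next
    assume "\<exists>H :: 'a pair_pre_digraph. pair_graph H \<and> graph_free T H \<and>
        digraph_iso (with_proj G) (with_proj (disjoint_union (complete_graph (t - 1)) H))"
    then obtain U where "isolated_clique G U" "card U = Suc m"
      using disjoint_union_isolated_clique[OF assms(5)] unfolding m(1) by blast
    then have "real \<Delta> \<le> clique_spectral_radius r G"
      unfolding \<Delta>_def by (rule clique_spectral_radius_isolated_clique[OF fin r(3)])
    then show "clique_spectral_radius r G = real \<Delta>" using upper by simp
  qed
  then show ?thesis
    using upper complete symmetry unfolding r_def[symmetric] m_def[symmetric] \<Delta>_def[symmetric]
    by simp
qed

end
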